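(* The triplet $(\overline{\mathbb{IR}},+,\cdot)$ is a real vector space.
   Context: $\mathbb{IR}$ is the set of intervals $[a,b]$ with real $a\le b$ (degenerate intervals $[a,a]$ allowed), with addition $[a,b]+[c,d]=[a+c,b+d]$ and, for $\alpha\ge 0$, $\alpha[a,b]=[\alpha a,\alpha b]$; $0$ also denotes $[0,0]$. $\overline{\mathbb{IR}}$ is the quotient of $\mathbb{IR}\times\mathbb{IR}$ by the equivalence relation $(x,y)\sim(z,t)\iff x+t=y+z$; the class of $(x,y)$ is $\overline{(x,y)}$. Addition is $\overline{(x,y)}+\overline{(z,t)}=\overline{(x+z,y+t)}$. Every element of $\overline{\mathbb{IR}}$ can be written $\overline{(A,0)}$ or $\overline{(0,A)}$ with $A\in\mathbb{IR}$. Scalar multiplication $\cdot:\mathbb{R}\times\overline{\mathbb{IR}}\to\overline{\mathbb{IR}}$: for $\alpha\ge 0$, $\alpha\cdot\overline{(A,0)}=\overline{(\alpha A,0)}$ and $\alpha\cdot\overline{(0,A)}=\overline{(0,\alpha A)}$; for $\alpha<0$, with $\beta=-\alpha$, $\alpha\cdot\overline{(A,0)}=\overline{(0,\beta A)}$ and $\alpha\cdot\overline{(0,A)}=\overline{(\beta A,0)}$. *)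

theory Defs
  imports Complex_Main "HOL-Library.Interval"
begin

type_synonym IR = "real interval"

text \<open>Multiplication of an interval by a scalar. Only the values for \<^term>\<open>0 \<le> \<alpha>\<close> are meaningful;
  for negative \<^term>\<open>\<alpha>\<close> the argument of \<^const>\<open>Interval\<close> is in general not a pair of ordered
  bounds, and the result is never used.\<close>

definition scale_IR :: "real \<Rightarrow> IR \<Rightarrow> IR" where
  "scale_IR \<alpha> A = Interval (\<alpha> * lower A, \<alpha> * upper A)"

lemma lower_Interval: "a \<le> b \<Longrightarrow> lower (Interval (a, b)) = (a::real)"
  and upper_Interval: "a \<le> b \<Longrightarrow> upper (Interval (a, b)) = (b::real)"
  by (simp_all add: lower.rep_eq upper.rep_eq Interval_inverse)

lemma lower_scale_IR: "0 \<le> \<alpha> \<Longrightarrow> lower (scale_IR \<alpha> A) = \<alpha> * lower A"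
  and upper_scale_IR: "0 \<le> \<alpha> \<Longrightarrow> upper (scale_IR \<alpha> A) = \<alpha> * upper A"
  by (simp_all add: scale_IR_def lower_Interval upper_Interval mult_left_mono)

fun IR_rel :: "IR \<times> IR \<Rightarrow> IR \<times> IR \<Rightarrow> bool" where
  "IR_rel (x, y) (z, t) \<longleftrightarrow> x + t = y + z"

quotient_type IR_bar = "IR \<times> IR" / IR_rel
  morphisms rep_IR_bar IR_class
  by (rule equivpI) (auto simp: reflp_def symp_def transp_def interval_eq_iff)

lift_definition plus_IR_bar :: "IR_bar \<Rightarrow> IR_bar \<Rightarrow> IR_bar"
  is "\<lambda>(x, y) (z, t). (x + z, y + t)"
  by (auto simp: interval_eq_iff)

lemma plus_IR_bar_class:
  "plus_IR_bar (IR_class (x, y)) (IR_class (z, t)) = IR_class (x + z, y + t)"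
  by (simp add: plus_IR_bar.abs_eq)

lemma IR_class_eq_iff: "IR_class (x, y) = IR_class (z, t) \<longleftrightarrow> x + t = y + z"
  by (simp add: IR_bar.abs_eq_iff)

lemma IR_bar_cases:
  obtains (pos) A where "X = IR_class (A, 0)" | (neg) A where "X = IR_class (0, A)"
proof -
  obtain x y where X: "X = IR_class (x, y)"
    by (metis Quotient3_IR_bar Quotient3_abs_rep surj_pair)
  show thesis
  proof (cases "lower x - lower y \<le> upper x - upper y")
    case True
    then have "X = IR_class (Interval (lower x - lower y, upper x - upper y), 0)"
      by (simp add: X IR_class_eq_iff interval_eq_iff lower_Interval upper_Interval)
    then show thesis by (rule pos)
  next
    case False
    then have "X = IR_class (0, Interval (lower y - lower x, upper y - upper x))"
      by (simp add: X IR_class_eq_iff interval_eq_iff lower_Interval upper_Interval)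
    then show thesis by (rule neg)
  qed
qed

text \<open>Scalar multiplication is defined on the representatives \<^term>\<open>(A, 0)\<close> and \<^term>\<open>(0, A)\<close>;
  the lemmas that follow show that the description is satisfied by exactly one value.\<close>

definition scale_IR_bar :: "real \<Rightarrow> IR_bar \<Rightarrow> IR_bar" where
  "scale_IR_bar \<alpha> X = (THE Y. \<exists>A.
     (X = IR_class (A, 0) \<and>
        Y = (if 0 \<le> \<alpha> then IR_class (scale_IR \<alpha> A, 0) else IR_class (0, scale_IR (- \<alpha>) A))) \<or>
     (X = IR_class (0, A) \<and>
        Y = (if 0 \<le> \<alpha> then IR_class (0, scale_IR \<alpha> A) else IR_class (scale_IR (- \<alpha>) A, 0))))"

lemma scale_IR_add_eq_0:
  assumes "0 \<le> \<alpha>" "A + B = 0"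
  shows "scale_IR \<alpha> A + scale_IR \<alpha> B = 0"
  using assms by (simp add: interval_eq_iff lower_scale_IR upper_scale_IR flip: distrib_left)

lemma scale_IR_bar_pos:
  "scale_IR_bar \<alpha> (IR_class (A, 0)) =
     (if 0 \<le> \<alpha> then IR_class (scale_IR \<alpha> A, 0) else IR_class (0, scale_IR (- \<alpha>) A))"
  unfolding scale_IR_bar_def
  by (rule the_equality) (auto simp: IR_class_eq_iff scale_IR_add_eq_0 add.commute)

lemma scale_IR_bar_neg:
  "scale_IR_bar \<alpha> (IR_class (0, A)) =
     (if 0 \<le> \<alpha> then IR_class (0, scale_IR \<alpha> A) else IR_class (scale_IR (- \<alpha>) A, 0))"
  unfolding scale_IR_bar_def
  by (rule the_equality) (auto simp: IR_class_eq_iff scale_IR_add_eq_0 add.commute)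

end

(* The differences of the lower and of the upper bounds of a representative are coordinates
   that embed the quotient into the plane and turn both operations into the coordinatewise
   ones, so the vector space axioms are inherited from the real numbers. *)

theory Submission
  imports Defs
begin

lift_definition lower_diff :: "IR_bar \<Rightarrow> real" is "\<lambda>(x, y). lower x - lower y"
  by (auto simp: interval_eq_iff)

lift_definition upper_diff :: "IR_bar \<Rightarrow> real" is "\<lambda>(x, y). upper x - upper y"
  by (auto simp: interval_eq_iff)

lemma lower_diff_class: "lower_diff (IR_class (x, y)) = lower x - lower y"
  and upper_diff_class: "upper_diff (IR_class (x, y)) = upper x - upper y"
  by (simp_all add: lower_diff.abs_eq upper_diff.abs_eq)

text \<open>Taken bound by bound, \<open>x + t = y + z\<close> rearranges to equality of the
  differences.\<close>

lemma IR_bar_eq_iff: "X = Y \<longleftrightarrow> lower_diff X = lower_diff Y \<and> upper_diff X = upper_diff Y"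
  by transfer (auto simp: interval_eq_iff)

lemma lower_diff_plus: "lower_diff (plus_IR_bar X Y) = lower_diff X + lower_diff Y"
  and upper_diff_plus: "upper_diff (plus_IR_bar X Y) = upper_diff X + upper_diff Y"
  by (transfer, auto)+

text \<open>For \<alpha> < 0 the factor \<open>- \<alpha>\<close> keeps lower and upper bounds in
  place, and swapping the two components supplies the missing sign.\<close>

lemma lower_diff_scale: "lower_diff (scale_IR_bar \<alpha> X) = \<alpha> * lower_diff X"
  and upper_diff_scale: "upper_diff (scale_IR_bar \<alpha> X) = \<alpha> * upper_diff X"
  by (cases X rule: IR_bar_cases;
      simp add: scale_IR_bar_pos scale_IR_bar_neg lower_diff_class upper_diff_class
        lower_scale_IR upper_scale_IR)+

theorem theorem9:
  shows "\<exists>zero sub neg. class.real_vector plus_IR_bar zero sub neg scale_IR_bar"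
proof (intro exI)
  \<comment> \<open>Taking negation to be scaling by -1 lets the coordinate rules for
    \<open>scale_IR_bar\<close> cover negation and subtraction too.\<close>
  show "class.real_vector plus_IR_bar (IR_class (0, 0))
    (\<lambda>X Y. plus_IR_bar X (scale_IR_bar (- 1) Y)) (scale_IR_bar (- 1)) scale_IR_bar"
    by unfold_locales
      (simp_all add: IR_bar_eq_iff lower_diff_plus upper_diff_plus lower_diff_scale
        upper_diff_scale lower_diff_class upper_diff_class algebra_simps)
qed

end
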